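(* Let $\mathcal X,\mathcal Y$ be normed vector spaces, $T:\mathcal X\to\mathcal Y$ a bounded linear operator, $\mathcal D$ a subset of $\mathcal X$, and $W:\mathcal D\to\mathbb R$ a functional such that: (1) there exists $\gamma\ge0$ such that $W(x)\ge-\gamma$ for every $x\in\mathcal D$; (2) every $T$-$W$-bounded sequence in $\mathcal D$ contains a subsequence converging weakly to an element of $\mathcal D$. Let $J,J_n:\mathcal D\to\mathbb R$, $n=1,2,\dots$, be functionals such that $J$ is $T$-$W$-subsequentially weakly lower semicontinuous and $\{J_n\}$ is $T$-$W$-coercive and $T$-$W$-uniformly consistent for $J$. Assume further that $J$ has a unique global minimizer $\bar x\in\mathcal D$ and that each functional $J_n$ possesses a global minimizer $x_n$ on $\mathcal D$ (not necessarily unique). Then $x_n$ converges weakly to $\bar x$.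
   Context: A sequence $\{x_n\}\subset\mathcal D$ is $T$-$W$-bounded if $\{\|Tx_n\|+W(x_n)\}$ is bounded in $\mathbb R$. $J$ is $T$-$W$-subsequentially weakly lower semicontinuous if for every $T$-$W$-bounded sequence $\{x_n\}\subset\mathcal D$ converging weakly to some $x\in\mathcal D$ there is a subsequence $\{x_{n_j}\}$ with $J(x)\le\liminf_{j\to\infty}J(x_{n_j})$. $\{J_n\}$ is $T$-$W$-coercive if $\lim_{n\to\infty}J_n(x_n)=+\infty$ for every sequence $\{x_n\}\subset\mathcal D$ with $\lim_{n\to\infty}\left(\|Tx_n\|+W(x_n)\right)=+\infty$. $\{J_n\}$ is $T$-$W$-uniformly consistent for $J$ if for any $c>0$ and $\epsilon>0$ there exists $N=N(c,\epsilon)$ such that $|J_n(x)-J(x)|<\epsilon$ for every $n\ge N$ and every $x\in\mathcal D$ with $\|Tx\|+|W(x)|\le c$. *)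

theory Defs
  imports "HOL-Analysis.Analysis"
begin

text \<open>
  Functionals on a subset \<open>D\<close> of a normed space are total functions whose values outside \<open>D\<close> are
  never inspected. Sequences, including that of the functionals \<open>J\<^sub>n\<close>, are indexed from 0.
\<close>

definition weakly_tendsto :: "(nat \<Rightarrow> 'a::real_normed_vector) \<Rightarrow> 'a \<Rightarrow> bool" where
  "weakly_tendsto x a \<longleftrightarrow>
     (\<forall>f :: 'a \<Rightarrow> real. bounded_linear f \<longrightarrow> (\<lambda>n. f (x n)) \<longlonglongrightarrow> f a)"

definition TW_bounded ::
  "('a::real_normed_vector \<Rightarrow> 'b::real_normed_vector) \<Rightarrow> ('a \<Rightarrow> real) \<Rightarrow> (nat \<Rightarrow> 'a) \<Rightarrow> bool" where
  "TW_bounded T W x \<longleftrightarrow> bounded (range (\<lambda>n. norm (T (x n)) + W (x n)))"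

text \<open>The liminf is taken in the extended reals, where it always exists.\<close>

definition TW_subseq_weakly_lsc ::
  "('a::real_normed_vector \<Rightarrow> 'b::real_normed_vector) \<Rightarrow> ('a \<Rightarrow> real) \<Rightarrow> 'a set
    \<Rightarrow> ('a \<Rightarrow> real) \<Rightarrow> bool" where
  "TW_subseq_weakly_lsc T W D J \<longleftrightarrow>
     (\<forall>x a. (\<forall>n. x n \<in> D) \<and> TW_bounded T W x \<and> a \<in> D \<and> weakly_tendsto x a \<longrightarrow>
        (\<exists>r :: nat \<Rightarrow> nat. strict_mono r \<and> ereal (J a) \<le> liminf (\<lambda>j. ereal (J (x (r j))))))"

definition TW_coercive ::
  "('a::real_normed_vector \<Rightarrow> 'b::real_normed_vector) \<Rightarrow> ('a \<Rightarrow> real) \<Rightarrow> 'a set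
    \<Rightarrow> (nat \<Rightarrow> 'a \<Rightarrow> real) \<Rightarrow> bool" where
  "TW_coercive T W D J \<longleftrightarrow>
     (\<forall>x. (\<forall>n. x n \<in> D) \<and> filterlim (\<lambda>n. norm (T (x n)) + W (x n)) at_top sequentially \<longrightarrow>
        filterlim (\<lambda>n. J n (x n)) at_top sequentially)"

definition TW_uniformly_consistent ::
  "('a::real_normed_vector \<Rightarrow> 'b::real_normed_vector) \<Rightarrow> ('a \<Rightarrow> real) \<Rightarrow> 'a set
    \<Rightarrow> (nat \<Rightarrow> 'a \<Rightarrow> real) \<Rightarrow> ('a \<Rightarrow> real) \<Rightarrow> bool" where
  "TW_uniformly_consistent T W D Jn J \<longleftrightarrow>
     (\<forall>c > 0. \<forall>e > 0. \<exists>N. \<forall>n \<ge> N. \<forall>x \<in> D.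
        norm (T x) + \<bar>W x\<bar> \<le> c \<longrightarrow> \<bar>Jn n x - J x\<bar> < e)"

end

theory Submission
  imports Defs
begin

text \<open>
  Write \<open>g n = \<parallel>T (x n)\<parallel> + W (x n)\<close>. Uniform consistency compares \<open>Jn\<close> with \<open>J\<close> only on sets where
  \<open>\<parallel>T y\<parallel> + \<bar>W y\<bar>\<close> stays bounded, so the crux is to confine the minimizers \<open>x n\<close> to such a set.
  Coercivity does this: the values \<open>Jn n (x n) \<le> Jn n xbar\<close> stay bounded, because the right-hand side
  converges to \<open>J xbar\<close> by consistency at the single point \<open>xbar\<close>. If \<open>g\<close> were unbounded, replacing
  \<open>x n\<close> by the term at which \<open>g\<close> is largest up to \<open>n\<close> would give a sequence to which coercivity applies
  and which agrees with \<open>x\<close> infinitely often, a contradiction (\<open>TW_coercive_imp_TW_bounded\<close>).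

  Once \<open>x\<close> is \<open>T\<close>-\<open>W\<close>-bounded, the chain
  \<open>J (x n) < Jn n (x n) + e \<le> Jn n xbar + e < J xbar + 2 * e\<close>, valid for large \<open>n\<close>, shows that \<open>x\<close>
  is a minimizing sequence of \<open>J\<close> (\<open>minimizers_eventually_almost_minimal\<close>). By compactness every
  subsequence of \<open>x\<close> has a weakly convergent subsequence; lower semicontinuity makes its limit a
  minimizer of \<open>J\<close>, which by uniqueness is \<open>xbar\<close>. As the limit is always the same, the whole
  sequence converges (\<open>weakly_tendsto_if_subsubseq\<close>).
\<close>

lemma TW_bounded_subseq: "TW_bounded T W x \<Longrightarrow> TW_bounded T W (x \<circ> r)"
  unfolding TW_bounded_def by (erule bounded_subset) auto

lemma weakly_tendsto_if_subsubseq: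
  assumes "\<And>s :: nat \<Rightarrow> nat. strict_mono s \<Longrightarrow>
             \<exists>r :: nat \<Rightarrow> nat. strict_mono r \<and> weakly_tendsto (x \<circ> s \<circ> r) a"
  shows "weakly_tendsto x a"
  unfolding weakly_tendsto_def
proof (intro allI impI tendstoI)
  fix f :: "'a \<Rightarrow> real" and e :: real
  assume f: "bounded_linear f" and e: "e > 0"
  show "\<forall>\<^sub>F n in sequentially. dist (f (x n)) (f a) < e"
  proof (rule ccontr)
    assume "\<not> ?thesis"
    then obtain s :: "nat \<Rightarrow> nat"
      where s: "strict_mono s" "\<And>n. \<not> dist (f (x (s n))) (f a) < e"
      using not_eventually_sequentiallyD by blast
    obtain r :: "nat \<Rightarrow> nat" where "weakly_tendsto (x \<circ> s \<circ> r) a"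
      using assms[OF s(1)] by blast
    then have "(\<lambda>n. f (x (s (r n)))) \<longlonglongrightarrow> f a"
      using f by (simp add: weakly_tendsto_def o_def)
    then have "\<forall>\<^sub>F n in sequentially. dist (f (x (s (r n)))) (f a) < e"
      using e by (rule tendstoD)
    then show False
      using s(2) by simp
  qed
qed

text \<open>
  The index \<open>p n\<close> at which \<open>g\<close> is largest among \<open>0, \<dots>, n\<close> turns an unbounded sequence into one
  diverging to infinity. The sequence \<open>p\<close> fixes infinitely many \<open>n\<close>, as the values
  \<open>p n\<close> themselves are unbounded and are fixed by \<open>p\<close>.
\<close>

lemma unbounded_running_argmax:
  fixes g :: "nat \<Rightarrow> real"
  assumes unbdd: "\<And>B. \<exists>n. g n > B"
  obtains p :: "nat \<Rightarrow> nat"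
  where "filterlim (\<lambda>n. g (p n)) at_top sequentially" "\<exists>\<^sub>F n in sequentially. p n = n"
proof -
  \<comment> \<open>Ties are broken by taking the least maximizing index, so that \<open>p\<close> is idempotent.\<close>
  define p where "p n = (LEAST m. m \<le> n \<and> (\<forall>i\<le>n. g i \<le> g m))" for n
  have "\<exists>m. m \<le> n \<and> (\<forall>i\<le>n. g i \<le> g m)" for n
  proof -
    have "finite (g ` {..n})" "g ` {..n} \<noteq> {}" by auto
    then have "Max (g ` {..n}) \<in> g ` {..n}" by (rule Max_in)
    then obtain m where "Max (g ` {..n}) = g m" "m \<in> {..n}" by (rule imageE)
    moreover have "g i \<le> Max (g ` {..n})" if "i \<le> n" for i using that by (intro Max_ge) auto
    ultimately show ?thesis by auto
  qed
  then have p: "p n \<le> n \<and> (\<forall>i\<le>n. g i \<le> g (p n))" for n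
    unfolding p_def by (rule LeastI_ex)
  have p_idem: "p (p n) = p n" for n
  proof (rule antisym)
    show "p (p n) \<le> p n" using p by blast
    have "p (p n) \<le> n \<and> (\<forall>i\<le>n. g i \<le> g (p (p n)))"
      using p[of n] p[of "p n"] by (meson order_refl order_trans)
    then show "p n \<le> p (p n)"
      by (subst p_def) (rule Least_le)
  qed
  have lim: "filterlim (\<lambda>n. g (p n)) at_top sequentially"
    unfolding filterlim_at_top
  proof
    fix B
    obtain m where "g m > B" using unbdd by blast
    then show "\<forall>\<^sub>F n in sequentially. B \<le> g (p n)"
      using p by (intro eventually_sequentiallyI[of m]) (meson less_imp_le order_trans)
  qed
  have "\<exists>n\<ge>N. p n = n" for N
  proof -
    obtain k where k: "g k > g (p N)" using unbdd by blast
    have "p k \<ge> N"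
      using p[of N] p[of k] k by (meson leD le_cases order_refl order_trans)
    then show ?thesis using p_idem by blast
  qed
  then have "\<exists>\<^sub>F n in sequentially. p n = n"
    by (simp add: frequently_sequentially)
  with lim show ?thesis by (rule that)
qed

text \<open>
  A bound on \<open>Jn n (x n)\<close> rules out unboundedness, not just divergence, of
  \<open>\<parallel>T (x n)\<parallel> + W (x n)\<close>. Coercivity speaks only of full sequences, in which the index of the functional
  is that of the point, so a subsequence of \<open>x\<close> has to be filled up to a full sequence first.
\<close>

lemma TW_coercive_imp_TW_bounded:
  assumes coercive: "TW_coercive T W D Jn"
    and W_lower: "\<And>y. y \<in> D \<Longrightarrow> W y \<ge> - \<gamma>"
    and x_in: "\<And>n. x n \<in> D"
    and Jn_le: "\<forall>\<^sub>F n in sequentially. Jn n (x n) \<le> C"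
  shows "TW_bounded T W x"
proof -
  define g where "g n = norm (T (x n)) + W (x n)" for n
  have g_lower: "- \<gamma> \<le> g n" for n
    using W_lower[OF x_in[of n]] by (simp add: g_def add_increasing)
  have "\<exists>B. \<forall>n. g n \<le> B"
  proof (rule ccontr)
    assume "\<nexists>B. \<forall>n. g n \<le> B"
    then have "\<exists>n. g n > B" for B by (meson not_le)
    then obtain p where p: "filterlim (\<lambda>n. g (p n)) at_top sequentially"
        "\<exists>\<^sub>F n in sequentially. p n = n"
      using unbounded_running_argmax[of g] by blast
    have "filterlim (\<lambda>n. Jn n (x (p n))) at_top sequentially"
      using coercive[unfolded TW_coercive_def, rule_format, of "\<lambda>n. x (p n)"] p(1) x_in
      by (simp add: g_def)
    then have "\<forall>\<^sub>F n in sequentially. Jn n (x (p n)) > C"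
      by (simp add: filterlim_at_top_dense)
    with Jn_le have "\<forall>\<^sub>F n in sequentially. p n \<noteq> n"
      by eventually_elim auto
    with p(2) show False
      by (simp add: frequently_def)
  qed
  then obtain B where "g n \<le> B" for n by blast
  then have "range g \<subseteq> {- \<gamma>..B}" using g_lower by auto
  then show ?thesis
    unfolding TW_bounded_def g_def[abs_def] by (rule bounded_subset[OF bounded_closed_interval])
qed

lemma TW_uniformly_consistentD:
  assumes "TW_uniformly_consistent T W D Jn J" and "e > 0"
  shows "\<forall>\<^sub>F n in sequentially. \<forall>y\<in>D. norm (T y) + \<bar>W y\<bar> \<le> c \<longrightarrow> \<bar>Jn n y - J y\<bar> < e"
proof -
  \<comment> \<open>Uniform consistency is stated for positive bounds only.\<close>
  have "max c 1 > 0" by simp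
  with assms obtain N where "\<forall>n\<ge>N. \<forall>y\<in>D. norm (T y) + \<bar>W y\<bar> \<le> max c 1 \<longrightarrow> \<bar>Jn n y - J y\<bar> < e"
    unfolding TW_uniformly_consistent_def by meson
  then show ?thesis by (intro eventually_sequentiallyI[of N]) auto
qed

lemma TW_uniformly_consistent_at:
  assumes "TW_uniformly_consistent T W D Jn J" and "e > 0" and "y \<in> D"
  shows "\<forall>\<^sub>F n in sequentially. \<bar>Jn n y - J y\<bar> < e"
  using TW_uniformly_consistentD[OF assms(1,2), of "norm (T y) + \<bar>W y\<bar>"]
  by eventually_elim (use assms(3) in blast)

text \<open>
  The lower bound on \<open>W\<close> converts the one-sided \<open>T\<close>-\<open>W\<close>-boundedness, in which \<open>W\<close> occurs with its
  sign, into the bound on \<open>\<parallel>T y\<parallel> + \<bar>W y\<bar>\<close> that uniform consistency asks for.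
\<close>

lemma TW_uniformly_consistent_along:
  assumes cons: "TW_uniformly_consistent T W D Jn J" and "e > 0"
    and W_lower: "\<And>y. y \<in> D \<Longrightarrow> W y \<ge> - \<gamma>" and "\<gamma> \<ge> 0"
    and x_in: "\<And>n. x n \<in> D" and bdd: "TW_bounded T W x"
  shows "\<forall>\<^sub>F n in sequentially. \<bar>Jn n (x n) - J (x n)\<bar> < e"
proof -
  obtain B where "\<bar>norm (T (x n)) + W (x n)\<bar> \<le> B" for n
    using bdd unfolding TW_bounded_def bounded_iff by auto
  then have "norm (T (x n)) + \<bar>W (x n)\<bar> \<le> B + 2 * \<gamma>" for n
    using W_lower[OF x_in[of n]] \<open>\<gamma> \<ge> 0\<close> by (smt (verit))
  with TW_uniformly_consistentD[OF cons \<open>e > 0\<close>, of "B + 2 * \<gamma>"] show ?thesis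
    by (auto elim!: eventually_mono simp: x_in)
qed

lemma minimizers_eventually_almost_minimal:
  assumes cons: "TW_uniformly_consistent T W D Jn J" and "e > 0"
    and W_lower: "\<And>y. y \<in> D \<Longrightarrow> W y \<ge> - \<gamma>" and "\<gamma> \<ge> 0"
    and x_in: "\<And>n. x n \<in> D" and bdd: "TW_bounded T W x"
    and y: "y \<in> D" and x_min: "\<And>n. Jn n (x n) \<le> Jn n y"
  shows "\<forall>\<^sub>F n in sequentially. J (x n) \<le> J y + e"
proof -
  have "e / 2 > 0" using \<open>e > 0\<close> by simp
  have "\<forall>\<^sub>F n in sequentially. \<bar>Jn n (x n) - J (x n)\<bar> < e / 2"
    using cons \<open>e / 2 > 0\<close> W_lower \<open>\<gamma> \<ge> 0\<close> x_in bdd by (rule TW_uniformly_consistent_along)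
  with TW_uniformly_consistent_at[OF cons \<open>e / 2 > 0\<close> y] show ?thesis
  proof eventually_elim
    case (elim n)
    with x_min[of n] show ?case by linarith
  qed
qed

text \<open>
  Passing to a further subsequence, as this form of lower semicontinuity does, is harmless because
  the upper bound on \<open>J (u n)\<close> survives it.
\<close>

lemma TW_subseq_weakly_lsc_le:
  assumes lsc: "TW_subseq_weakly_lsc T W D J"
    and u: "\<And>n. u n \<in> D" "TW_bounded T W u" and a: "a \<in> D" "weakly_tendsto u a"
    and upper: "\<And>e. e > 0 \<Longrightarrow> \<forall>\<^sub>F n in sequentially. J (u n) \<le> M + e"
  shows "J a \<le> M"
proof (rule field_le_epsilon)
  fix e :: real assume "e > 0"
  obtain r :: "nat \<Rightarrow> nat" where r: "strict_mono r"
      and le: "ereal (J a) \<le> liminf (\<lambda>j. ereal (J (u (r j))))"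
    using lsc u a unfolding TW_subseq_weakly_lsc_def by blast
  note le
  also have "liminf (\<lambda>j. ereal (J (u (r j)))) \<le> limsup (\<lambda>j. ereal (J (u (r j))))"
    by (intro Liminf_le_Limsup) simp
  also have "\<dots> \<le> ereal (M + e)"
    using eventually_subseq[OF r upper[OF \<open>e > 0\<close>]] by (intro Limsup_bounded) simp
  finally show "J a \<le> M + e" by simp
qed

theorem theorem3p8:
  fixes T :: "'a::real_normed_vector \<Rightarrow> 'b::real_normed_vector"
    and D :: "'a set"
    and W :: "'a \<Rightarrow> real"
    and J :: "'a \<Rightarrow> real"
    and Jn :: "nat \<Rightarrow> 'a \<Rightarrow> real"
    and xbar :: 'a
    and x :: "nat \<Rightarrow> 'a"
  assumes "bounded_linear T"
    and "\<exists>\<gamma> \<ge> 0. \<forall>y \<in> D. W y \<ge> - \<gamma>"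
    and "\<And>u :: nat \<Rightarrow> 'a. (\<forall>n. u n \<in> D) \<Longrightarrow> TW_bounded T W u \<Longrightarrow>
           \<exists>r :: nat \<Rightarrow> nat. \<exists>a \<in> D. strict_mono r \<and> weakly_tendsto (u \<circ> r) a"
    and "TW_subseq_weakly_lsc T W D J"
    and "TW_coercive T W D Jn"
    and "TW_uniformly_consistent T W D Jn J"
    and "is_arg_min J (\<lambda>y. y \<in> D) xbar"
    and "\<And>y. is_arg_min J (\<lambda>z. z \<in> D) y \<Longrightarrow> y = xbar"
    and "\<And>n. is_arg_min (Jn n) (\<lambda>y. y \<in> D) (x n)"
  shows "weakly_tendsto x xbar"
proof -
  note compact = assms(3)
  obtain \<gamma> where \<gamma>: "\<gamma> \<ge> 0" and W_lower: "\<And>y. y \<in> D \<Longrightarrow> W y \<ge> - \<gamma>"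
    using assms(2) by blast
  have xbar: "xbar \<in> D" and xbar_min: "\<And>y. y \<in> D \<Longrightarrow> J xbar \<le> J y"
    using assms(7) by (auto simp: is_arg_min_linorder)
  have x_in: "\<And>n. x n \<in> D" and x_min: "\<And>n. Jn n (x n) \<le> Jn n xbar"
    using assms(9) xbar by (auto simp: is_arg_min_linorder)
  have "\<forall>\<^sub>F n in sequentially. Jn n (x n) \<le> J xbar + 1"
    using TW_uniformly_consistent_at[OF assms(6) zero_less_one xbar]
  proof eventually_elim
    case (elim n)
    with x_min[of n] show ?case by (simp add: abs_less_iff)
  qed
  with assms(5) W_lower x_in have bdd: "TW_bounded T W x"
    by (rule TW_coercive_imp_TW_bounded)
  have upper: "\<forall>\<^sub>F n in sequentially. J (x n) \<le> J xbar + e" if "e > 0" for e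
    using assms(6) that W_lower \<gamma> x_in bdd xbar x_min
    by (rule minimizers_eventually_almost_minimal)
  show ?thesis
  proof (rule weakly_tendsto_if_subsubseq)
    fix s :: "nat \<Rightarrow> nat" assume s: "strict_mono s"
    obtain r :: "nat \<Rightarrow> nat" and a
      where a: "a \<in> D" and r: "strict_mono r" and lim: "weakly_tendsto (x \<circ> s \<circ> r) a"
      using compact[of "x \<circ> s"] x_in TW_bounded_subseq[OF bdd] by auto
    have sr: "strict_mono (s \<circ> r)" using s r by (rule strict_mono_o)
    have "J a \<le> J xbar"
    proof (rule TW_subseq_weakly_lsc_le[OF assms(4) _ _ a lim])
      show "TW_bounded T W (x \<circ> s \<circ> r)" using bdd by (intro TW_bounded_subseq)
      show "(x \<circ> s \<circ> r) n \<in> D" for n by (simp add: x_in)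
      show "\<forall>\<^sub>F n in sequentially. J ((x \<circ> s \<circ> r) n) \<le> J xbar + e" if "e > 0" for e
        using eventually_subseq[OF sr upper[OF that]] by simp
    qed
    then have "is_arg_min J (\<lambda>y. y \<in> D) a"
      using a xbar_min by (auto simp: is_arg_min_linorder intro: order_trans)
    then have "a = xbar" by (rule assms(8))
    with r lim show "\<exists>r :: nat \<Rightarrow> nat. strict_mono r \<and> weakly_tendsto (x \<circ> s \<circ> r) xbar" by blast
  qed
qed

end
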